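(* Up to isomorphism there are exactly two $3$-regular graphs with girth $5$ and diameter $4$ that have order $3^2+3+2=14$. One of them has automorphism group of order $12$ and the other has automorphism group of order $4$.
   Context: Graphs are finite, simple and undirected. The order of a graph is its number of vertices; its diameter is the maximum distance between a pair of its vertices (so a graph of finite diameter is connected); its girth is the length of its smallest circuit. *)

theory Defs
  imports "Graph_Theory.Graph_Theory" "HOL-Library.Extended_Nat" "HOL-Algebra.Coset" "HOL-Algebra.Bij"
begin

text \<open>
  A finite simple undirected graph is a \<^const>\<open>pair_graph\<close>: a finite vertex set with a finite,
  symmetric, irreflexive set of ordered pairs, each edge being represented by both of its
  orientations. Consequently the degree of a vertex is its \<^const>\<open>out_degree\<close>, and order means
  the number of vertices.
\<close>

definition regular_graph :: "nat \<Rightarrow> 'a pair_pre_digraph \<Rightarrow> bool" where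
  "regular_graph k G \<longleftrightarrow>
     pair_graph G \<and> (\<forall>v \<in> pverts G. out_degree (with_proj G) v = k)"

text \<open>
  The library's shortest-path distance for unit weights; it is \<^term>\<open>\<infinity> :: ereal\<close> between
  vertices of different components, so a graph of finite diameter is connected.
\<close>

definition graph_dist :: "'a pair_pre_digraph \<Rightarrow> 'a \<Rightarrow> 'a \<Rightarrow> ereal" where
  "graph_dist G u v = wf_digraph.\<mu> (with_proj G) (\<lambda>_. 1) u v"

definition graph_diameter :: "'a pair_pre_digraph \<Rightarrow> ereal" where
  "graph_diameter G = (SUP u \<in> pverts G. SUP v \<in> pverts G. graph_dist G u v)"

text \<open>
  The library's cycles include the walk \<open>u, v, u\<close> along both orientations of one edge; the
  bound on the length removes exactly these. The girth of an acyclic graph is infinite.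
\<close>

definition circuit :: "'a pair_pre_digraph \<Rightarrow> ('a \<times> 'a) awalk \<Rightarrow> bool" where
  "circuit G p \<longleftrightarrow> pre_digraph.cycle (with_proj G) p \<and> 3 \<le> length p"

definition graph_girth :: "'a pair_pre_digraph \<Rightarrow> enat" where
  "graph_girth G = (INF p \<in> {p. circuit G p}. enat (length p))"

text \<open>
  Automorphisms are adjacency-preserving bijections of the vertex set. As members of
  \<^const>\<open>Bij\<close> they are \<^const>\<open>undefined\<close> outside the vertex set, so that each is counted once.
\<close>

definition graph_auto :: "'a pair_pre_digraph \<Rightarrow> ('a \<Rightarrow> 'a) set" where
  "graph_auto G =
     {f \<in> Bij (pverts G).
        \<forall>u \<in> pverts G. \<forall>v \<in> pverts G. (f u, f v) \<in> parcs G \<longleftrightarrow> (u, v) \<in> parcs G}"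

definition graph_AutoGroup :: "'a pair_pre_digraph \<Rightarrow> ('a \<Rightarrow> 'a) monoid" where
  "graph_AutoGroup G = BijGroup (pverts G) \<lparr>carrier := graph_auto G\<rparr>"

lemma subgroup_graph_auto: "subgroup (graph_auto G) (BijGroup (pverts G))"
proof (rule group.subgroupI[OF group_BijGroup])
  show "graph_auto G \<subseteq> carrier (BijGroup (pverts G))"
    by (auto simp: graph_auto_def BijGroup_def)
  have "(\<lambda>x \<in> pverts G. x) \<in> graph_auto G"
    by (auto simp: graph_auto_def id_Bij)
  then show "graph_auto G \<noteq> {}" by blast
next
  fix f assume f: "f \<in> graph_auto G"
  then have fB: "f \<in> Bij (pverts G)" by (simp add: graph_auto_def)
  let ?g = "\<lambda>x \<in> pverts G. inv_into (pverts G) f x"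
  have bij: "bij_betw f (pverts G) (pverts G)"
    using fB by (simp add: Bij_def)
  have mem: "inv_into (pverts G) f x \<in> pverts G" "f (inv_into (pverts G) f x) = x"
    if "x \<in> pverts G" for x
    using that bij by (auto simp: bij_betw_def inv_into_into f_inv_into_f)
  have "(?g u, ?g v) \<in> parcs G \<longleftrightarrow> (u, v) \<in> parcs G"
    if "u \<in> pverts G" "v \<in> pverts G" for u v
    using f mem[OF that(1)] mem[OF that(2)] that unfolding graph_auto_def by force
  then show "inv\<^bsub>BijGroup (pverts G)\<^esub> f \<in> graph_auto G"
    using fB by (auto simp: inv_BijGroup graph_auto_def restrict_inv_into_Bij)
next
  fix f g assume fg: "f \<in> graph_auto G" "g \<in> graph_auto G"
  then have B: "f \<in> Bij (pverts G)" "g \<in> Bij (pverts G)" by (simp_all add: graph_auto_def)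
  have "g u \<in> pverts G" if "u \<in> pverts G" for u
    using Bij_imp_funcset[OF B(2)] that by auto
  then show "f \<otimes>\<^bsub>BijGroup (pverts G)\<^esub> g \<in> graph_auto G"
    using fg B by (auto simp: BijGroup_def graph_auto_def compose_Bij compose_eq)
qed

lemma group_graph_AutoGroup: "group (graph_AutoGroup G)"
  unfolding graph_AutoGroup_def
  by (rule subgroup.subgroup_is_group[OF subgroup_graph_auto group_BijGroup])

definition graph_isomorphic :: "'a pair_pre_digraph \<Rightarrow> 'b pair_pre_digraph \<Rightarrow> bool" where
  "graph_isomorphic G H \<longleftrightarrow> digraph_iso (with_proj G) (with_proj H)"

end

theory Submission
  imports Defs
begin

text \<open>
  Take two vertices \<open>x\<close> and \<open>y\<close> at distance 4. As there are no triangles and no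
  quadrilaterals, \<open>x\<close> has 3 neighbours and 6 vertices at distance 2. The closed neighbourhood of
  \<open>y\<close> has 4 elements and avoids all of these, and \<open>1 + 3 + 6 + 4 = 14\<close>; hence there are no other
  vertices, and the same six vertices are at distance 2 from \<open>y\<close> (lemmas \<open>verts_eq\<close> and
  \<open>sphere2_y\<close>). Each of these six has one neighbour adjacent to \<open>x\<close>, one adjacent to \<open>y\<close>, and
  one among the six (lemma \<open>nbrs_S\<close>). So the six vertices carry three perfect matchings: having
  a common neighbour adjacent to \<open>x\<close>, having one adjacent to \<open>y\<close>, and being adjacent. A
  pair that belongs to two of them would give a triangle or a quadrilateral, so they are
  disjoint.

  The first two matchings together form a hexagon (lemma \<open>two_matchings_hexagon\<close>), and the third
  consists of chords. Up to rotations of the hexagon that respect the first two matchings there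
  are two possibilities, namely three long diagonals, or one long diagonal and two short ones
  (lemma \<open>three_matchings\<close>). As the three matchings determine the graph, there are at
  most two graphs.

  That both graphs have the required girth and diameter, that their automorphism groups have
  orders 12 and 4, and that they are not isomorphic is a finite computation. An isomorphism
  is represented by the list of images of the vertices; a backtracking search, proved to be
  exhaustive in lemma \<open>labelling_iff_labellings\<close>, finds all such lists, and its result is
  evaluated by rewriting with the defining equations.
\<close>

section \<open>Neighbourhoods, short circuits and distances\<close>

definition nbrs :: "'a pair_pre_digraph \<Rightarrow> 'a \<Rightarrow> 'a set" where
  "nbrs G v = {w. (v, w) \<in> parcs G}"

definition triangle_free :: "'a pair_pre_digraph \<Rightarrow> bool" where
  "triangle_free G \<longleftrightarrow> (\<forall>a b c. b \<in> nbrs G a \<longrightarrow> c \<in> nbrs G b \<longrightarrow> c \<notin> nbrs G a)"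

definition quad_free :: "'a pair_pre_digraph \<Rightarrow> bool" where
  "quad_free G \<longleftrightarrow> (\<forall>a b c d. b \<in> nbrs G a \<longrightarrow> c \<in> nbrs G b \<longrightarrow> c \<noteq> a \<longrightarrow>
     d \<in> nbrs G a \<longrightarrow> c \<in> nbrs G d \<longrightarrow> d = b)"

lemma nbrs_sym: "pair_graph G \<Longrightarrow> w \<in> nbrs G v \<Longrightarrow> v \<in> nbrs G w"
  using pair_sym_digraph.arcs_symmetric[of G]
  by (auto simp: nbrs_def pair_graph_def pair_pseudo_graph_def)

lemma nbrs_irrefl: "pair_graph G \<Longrightarrow> v \<notin> nbrs G v"
  using pair_loopfree_digraph.pair_no_loops[of G "(v, v)"]
  by (auto simp: nbrs_def pair_graph_def pair_digraph_def)

lemma pair_graph_wf: "pair_graph G \<Longrightarrow> pair_wf_digraph G"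
  by (simp add: pair_graph_def pair_digraph_def pair_fin_digraph_def)

lemma pair_graph_finite: "pair_graph G \<Longrightarrow> finite (pverts G)"
  by (simp add: pair_graph_def pair_digraph_def pair_fin_digraph_def pair_fin_digraph_axioms_def)

lemma nbrs_subset: "pair_wf_digraph G \<Longrightarrow> nbrs G v \<subseteq> pverts G"
  using pair_wf_digraph.in_arcsD2[of G] by (auto simp: nbrs_def)

lemma nbrs_nonvertex: "pair_wf_digraph G \<Longrightarrow> v \<notin> pverts G \<Longrightarrow> nbrs G v = {}"
  using pair_wf_digraph.in_arcsD1[of G] by (auto simp: nbrs_def)

lemma regular_graph_iff_card_nbrs:
  "regular_graph k G \<longleftrightarrow> pair_graph G \<and> (\<forall>v \<in> pverts G. card (nbrs G v) = k)"
proof -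
  have "out_degree (with_proj G) v = card (nbrs G v)" for v
  proof -
    have "out_arcs (with_proj G) v = Pair v ` nbrs G v"
      by (auto simp: out_arcs_def nbrs_def)
    then show ?thesis
      by (simp add: out_degree_def card_image inj_on_def)
  qed
  then show ?thesis by (simp add: regular_graph_def)
qed

lemma circuit_iff:
  assumes "pair_wf_digraph G"
  shows "circuit G p \<longleftrightarrow>
    3 \<le> length p \<and> set p \<subseteq> parcs G \<and> (\<exists>u. pcas u p u) \<and> distinct (map snd p)"
proof -
  interpret pair_wf_digraph G by fact
  have "distinct (tl (pawalk_verts u p)) \<longleftrightarrow> distinct (map snd p)" if "pcas u p u" for u
    using awalk_verts_conv'[OF that] by simp
  moreover have "u \<in> pverts G" if "pcas u p u" "set p \<subseteq> parcs G" "p \<noteq> []" for u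
    using that by (cases p) (auto dest: in_arcsD1)
  ultimately show ?thesis
    unfolding circuit_def cycle_def awalk_def by (auto simp: Suc_le_length_iff numeral_3_eq_3)
qed

text \<open>
  A lower bound of 5 on the girth becomes a statement about neighbourhoods, free of closed walks.
  In this form it enters the counting arguments and can be tested on adjacency lists.
\<close>

lemma girth_ge_5_iff:
  assumes G: "pair_graph G"
  shows "5 \<le> graph_girth G \<longleftrightarrow> triangle_free G \<and> quad_free G"
proof
  assume "5 \<le> graph_girth G"
  then have ge: "5 \<le> length p" if "circuit G p" for p
    using that by (auto simp: graph_girth_def le_INF_iff numeral_eq_enat)
  note iff = circuit_iff[OF pair_graph_wf[OF G]]
  have "triangle_free G"
    unfolding triangle_free_def
  proof (intro allI impI notI)
    fix a b c assume "b \<in> nbrs G a" "c \<in> nbrs G b" "c \<in> nbrs G a"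
    then have "circuit G [(a, b), (b, c), (c, a)]"
      using nbrs_sym[OF G] nbrs_irrefl[OF G] unfolding iff by (auto simp: nbrs_def)
    from ge[OF this] show False by simp
  qed
  moreover have "quad_free G"
    unfolding quad_free_def
  proof (intro allI impI, rule ccontr)
    fix a b c d assume "b \<in> nbrs G a" "c \<in> nbrs G b" "c \<noteq> a" "d \<in> nbrs G a" "c \<in> nbrs G d" "d \<noteq> b"
    then have "circuit G [(a, b), (b, c), (c, d), (d, a)]"
      using nbrs_sym[OF G] nbrs_irrefl[OF G] unfolding iff by (auto simp: nbrs_def)
    from ge[OF this] show False by simp
  qed
  ultimately show "triangle_free G \<and> quad_free G" by simp
next
  assume free: "triangle_free G \<and> quad_free G"
  have "5 \<le> length p" if "circuit G p" for p
  proof (rule ccontr)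
    assume "\<not> 5 \<le> length p"
    moreover from that have p: "3 \<le> length p" "set p \<subseteq> parcs G" "\<exists>u. pcas u p u" "distinct (map snd p)"
      unfolding circuit_iff[OF pair_graph_wf[OF G]] by auto
    ultimately consider "length p = 3" | "length p = 4" by linarith
    then show False
    proof cases
      case 1
      then obtain a b c where "p = [(c, a), (a, b), (b, c)]"
        using p by (auto simp: length_Suc_conv numeral_eq_Suc)
      then have "a \<in> nbrs G c" "b \<in> nbrs G a" "c \<in> nbrs G b"
        using p by (auto simp: nbrs_def)
      then show False
        using free nbrs_sym[OF G] unfolding triangle_free_def by blast
    next
      case 2
      then obtain a b c d where "p = [(d, a), (a, b), (b, c), (c, d)]"
        using p by (auto simp: length_Suc_conv numeral_eq_Suc)
      then have "a \<in> nbrs G d" "b \<in> nbrs G a" "c \<in> nbrs G b" "d \<in> nbrs G c" "b \<noteq> d" "a \<noteq> c"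
        using p by (auto simp: nbrs_def)
      then show False
        using free nbrs_sym[OF G] unfolding quad_free_def by blast
    qed
  qed
  then show "5 \<le> graph_girth G"
    by (auto simp: graph_girth_def le_INF_iff numeral_eq_enat)
qed

text \<open>
  Recursion on the radius makes both uses possible: evaluation on a concrete graph, and
  unfolding \<^term>\<open>y \<notin> ball_of H 3 x\<close> into facts about neighbours.
\<close>

primrec ball_of :: "'a pair_pre_digraph \<Rightarrow> nat \<Rightarrow> 'a \<Rightarrow> 'a set" where
  "ball_of G 0 u = {u}"
| "ball_of G (Suc n) u = insert u (\<Union>w \<in> nbrs G u. ball_of G n w)"

lemma ball_of_iff_walk:
  assumes "pair_wf_digraph G" "u \<in> pverts G"
  shows "v \<in> ball_of G n u \<longleftrightarrow> (\<exists>p. pre_digraph.awalk (with_proj G) u p v \<and> length p \<le> n)"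
proof -
  interpret pair_wf_digraph G by fact
  show ?thesis
    using assms(2)
  proof (induction n arbitrary: u)
    case 0
    then show ?case by (auto simp: awalk_Nil_iff)
  next
    case (Suc n)
    have "(\<exists>p. awalk u p v \<and> length p \<le> Suc n) \<longleftrightarrow>
      v = u \<or> (\<exists>w p. (u, w) \<in> parcs G \<and> awalk w p v \<and> length p \<le> n)"
      (is "?L \<longleftrightarrow> ?R")
    proof
      assume ?L
      then obtain p where "awalk u p v" "length p \<le> Suc n" by blast
      then show ?R by (cases p) (auto simp: awalk_Nil_iff awalk_Cons_iff)
    next
      assume ?R
      then show ?L
      proof
        assume "v = u"
        then have "awalk u [] v" using Suc.prems by (simp add: awalk_Nil_iff)
        then show ?L by (metis le0 list.size(3))
      next
        assume "\<exists>w p. (u, w) \<in> parcs G \<and> awalk w p v \<and> length p \<le> n"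
        then obtain w p where "(u, w) \<in> parcs G" "awalk w p v" "length p \<le> n" by blast
        then have "awalk u ((u, w) # p) v" "length ((u, w) # p) \<le> Suc n"
          by (auto simp: awalk_Cons_iff)
        then show ?L by blast
      qed
    qed
    moreover have "w \<in> pverts G" if "w \<in> nbrs G u" for w
      using that nbrs_subset[OF assms(1)] by blast
    ultimately show ?case
      using Suc.IH by (auto simp: nbrs_def)
  qed
qed

text \<open>
  The distance is an infimum in the extended reals. As all walk lengths are natural numbers,
  it cannot lie strictly between \<^term>\<open>n\<close> and \<^term>\<open>Suc n\<close>; this is why
  a diameter can be read off from balls.
\<close>

lemma graph_dist_ge_Suc:
  assumes "pair_wf_digraph G" "u \<in> pverts G" "v \<notin> ball_of G n u"
  shows "ereal (Suc n) \<le> graph_dist G u v"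
proof -
  interpret pair_wf_digraph G by fact
  have "Suc n \<le> length p" if "awalk u p v" for p
    using assms that ball_of_iff_walk[of G u v n] not_less_eq_eq by blast
  moreover have "awalk_cost (\<lambda>_. 1) p = length p" for p
    by (simp add: awalk_cost_def sum_list_triv)
  ultimately show ?thesis
    unfolding graph_dist_def \<mu>_def by (auto simp: le_INF_iff simp del: of_nat_Suc)
qed

lemma graph_dist_le_iff:
  assumes "pair_wf_digraph G" "u \<in> pverts G"
  shows "graph_dist G u v \<le> ereal n \<longleftrightarrow> v \<in> ball_of G n u"
proof
  interpret pair_wf_digraph G by fact
  assume "v \<in> ball_of G n u"
  then obtain p where p: "awalk u p v" "length p \<le> n"
    using ball_of_iff_walk[OF assms] by blast
  have "graph_dist G u v \<le> awalk_cost (\<lambda>_. 1) p"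
    unfolding graph_dist_def by (rule min_cost_le_walk_cost[OF p(1)])
  also have "\<dots> \<le> ereal n"
    using p(2) by (simp add: awalk_cost_def sum_list_triv)
  finally show "graph_dist G u v \<le> ereal n" .
next
  assume le: "graph_dist G u v \<le> ereal n"
  show "v \<in> ball_of G n u"
  proof (rule ccontr)
    assume "v \<notin> ball_of G n u"
    from order_trans[OF graph_dist_ge_Suc[OF assms this] le] show False by simp
  qed
qed

lemma graph_diameter_eq_Suc_iff:
  assumes "pair_wf_digraph G"
  shows "graph_diameter G = ereal (Suc n) \<longleftrightarrow>
    (\<forall>u \<in> pverts G. pverts G \<subseteq> ball_of G (Suc n) u) \<and>
    (\<exists>u \<in> pverts G. \<exists>v \<in> pverts G. v \<notin> ball_of G n u)"
    (is "_ \<longleftrightarrow> ?U \<and> ?L")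
proof -
  have le: "graph_diameter G \<le> ereal k \<longleftrightarrow> (\<forall>u \<in> pverts G. pverts G \<subseteq> ball_of G k u)" for k :: nat
    using graph_dist_le_iff[OF assms] by (auto simp: graph_diameter_def SUP_le_iff)
  have "ereal (Suc n) \<le> graph_diameter G \<longleftrightarrow> ?L"
  proof
    assume "ereal (Suc n) \<le> graph_diameter G"
    then have "\<not> graph_diameter G \<le> ereal n"
      using order_trans[of "ereal (Suc n)" "graph_diameter G" "ereal n"] by auto
    then show ?L unfolding le by blast
  next
    assume ?L
    then obtain u v where uv: "u \<in> pverts G" "v \<in> pverts G" "v \<notin> ball_of G n u" by blast
    then have "ereal (Suc n) \<le> graph_dist G u v" by (intro graph_dist_ge_Suc[OF assms])
    also have "\<dots> \<le> graph_diameter G"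
      unfolding graph_diameter_def using uv by (intro SUP_upper2[OF uv(1)] SUP_upper)
    finally show "ereal (Suc n) \<le> graph_diameter G" .
  qed
  then show ?thesis using le[of "Suc n"] by (auto intro: antisym)
qed

text \<open>
  An isomorphism of general digraphs carries separate maps on arcs, heads and tails. Without
  parallel arcs they are all determined by the map on vertices.
\<close>

lemma graph_isomorphic_iff:
  assumes "pair_wf_digraph G" "pair_wf_digraph H"
  shows "graph_isomorphic G H \<longleftrightarrow>
    (\<exists>f. bij_betw f (pverts G) (pverts H) \<and> (\<forall>u \<in> pverts G. nbrs H (f u) = f ` nbrs G u))"
    (is "_ \<longleftrightarrow> (\<exists>f. ?iso f)")
proof
  assume "graph_isomorphic G H"
  then obtain h where h: "pre_digraph.digraph_isomorphism (with_proj G) h"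
    and H: "with_proj H = app_iso h (with_proj G)"
    by (auto simp: graph_isomorphic_def digraph_iso_def)
  let ?f = "iso_verts h"
  have V: "pverts H = ?f ` pverts G" and E: "parcs H = iso_arcs h ` parcs G"
    using arg_cong[OF H, of verts] arg_cong[OF H, of arcs] by simp_all
  have ht: "iso_tail h = fst" "iso_head h = snd"
    using arg_cong[OF H, of tail] arg_cong[OF H, of head] by simp_all
  have inj: "inj_on ?f (pverts G)"
    using h by (simp add: pre_digraph.digraph_isomorphism_def)
  have "iso_arcs h e = (?f (fst e), ?f (snd e))" if "e \<in> parcs G" for e
    using h that by (auto simp: pre_digraph.digraph_isomorphism_def ht prod_eq_iff)
  then have E': "parcs H = (\<lambda>e. (?f (fst e), ?f (snd e))) ` parcs G"
    unfolding E by (intro image_cong) auto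
  have "nbrs H (?f u) = ?f ` nbrs G u" if u: "u \<in> pverts G" for u
  proof -
    have "e \<in> parcs G \<Longrightarrow> ?f (fst e) = ?f u \<Longrightarrow> fst e = u" for e
      using inj_onD[OF inj _ pair_wf_digraph.arc_fst_in_verts[OF assms(1)] u] by blast
    then show ?thesis unfolding nbrs_def E' by force
  qed
  then have "?iso ?f" using inj V by (simp add: bij_betw_def)
  then show "\<exists>f. ?iso f" by blast
next
  assume "\<exists>f. ?iso f"
  then obtain f where f: "bij_betw f (pverts G) (pverts H)"
    and nb: "\<And>u. u \<in> pverts G \<Longrightarrow> nbrs H (f u) = f ` nbrs G u" by blast
  define h :: "('a, 'a \<times> 'a, 'b, 'b \<times> 'b) digraph_isomorphism" where
    "h = \<lparr>iso_verts = f, iso_arcs = map_prod f f, iso_head = snd, iso_tail = fst\<rparr>"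
  have inj: "inj_on f (pverts G)" and V: "pverts H = f ` pverts G"
    using f by (auto simp: bij_betw_def)
  have sub: "parcs G \<subseteq> pverts G \<times> pverts G"
    using assms(1) by (force simp: pair_wf_digraph_def)
  have "parcs H = map_prod f f ` parcs G"
  proof (intro equalityI subsetI)
    fix e assume e: "e \<in> parcs H"
    then obtain u where u: "u \<in> pverts G" "fst e = f u"
      using pair_wf_digraph.arc_fst_in_verts[OF assms(2) e] V by blast
    then have "snd e \<in> f ` nbrs G u"
      using e nb[OF u(1)] by (cases e) (auto simp: nbrs_def)
    then show "e \<in> map_prod f f ` parcs G"
      using u by (cases e) (auto simp: nbrs_def)
  next
    fix e assume "e \<in> map_prod f f ` parcs G"
    then obtain u v where uv: "(u, v) \<in> parcs G" "e = (f u, f v)" by auto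
    then have "f v \<in> nbrs H (f u)" using nb sub by (auto simp: nbrs_def)
    then show "e \<in> parcs H" using uv by (simp add: nbrs_def)
  qed
  then have "with_proj H = app_iso h (with_proj G)"
    by (simp add: h_def app_iso_def with_proj_def V)
  moreover have "pre_digraph.digraph_isomorphism (with_proj G) h"
    using inj inj_on_subset[OF map_prod_inj_on[OF inj inj] sub] assms(1)
    by (auto simp: pre_digraph.digraph_isomorphism_def h_def wf_digraph_wp_iff)
  ultimately show "graph_isomorphic G H"
    unfolding graph_isomorphic_def digraph_iso_def by blast
qed

lemma graph_isomorphic_sym:
  assumes "graph_isomorphic G H"
  shows "graph_isomorphic H G"
proof -
  obtain h where h: "pre_digraph.digraph_isomorphism (with_proj G) h"
    and H: "with_proj H = app_iso h (with_proj G)"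
    using assms by (auto simp: graph_isomorphic_def digraph_iso_def)
  interpret wf_digraph "with_proj G"
    using h by (simp add: pre_digraph.digraph_isomorphism_def)
  show ?thesis
    using digraph_isomorphism_invI[OF h] app_iso_inv[OF h]
    unfolding graph_isomorphic_def digraph_iso_def H by metis
qed

section \<open>Graphs given by adjacency lists\<close>

definition adj_graph :: "nat list list \<Rightarrow> nat pair_pre_digraph" where
  "adj_graph nb = \<lparr>pverts = {..<length nb}, parcs = {(i, j). i < length nb \<and> j \<in> set (nb ! i)}\<rparr>"

lemma pverts_adj_graph [simp]: "pverts (adj_graph nb) = {..<length nb}"
  by (simp add: adj_graph_def)

lemma nbrs_adj_graph: "i < length nb \<Longrightarrow> nbrs (adj_graph nb) i = set (nb ! i)"
  by (simp add: adj_graph_def nbrs_def)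

definition cubic_adj :: "nat list list \<Rightarrow> bool" where
  "cubic_adj nb \<longleftrightarrow> (\<forall>i \<in> set [0..<length nb]. length (nb ! i) = 3 \<and> distinct (nb ! i) \<and>
     (\<forall>j \<in> set (nb ! i). j < length nb \<and> j \<noteq> i \<and> i \<in> set (nb ! j)))"

lemma cubic_adjD:
  assumes "cubic_adj nb" "i < length nb"
  shows "length (nb ! i) = 3" "distinct (nb ! i)"
    and "j \<in> set (nb ! i) \<Longrightarrow> j < length nb"
    and "j \<in> set (nb ! i) \<Longrightarrow> j \<noteq> i"
    and "j \<in> set (nb ! i) \<Longrightarrow> i \<in> set (nb ! j)"
proof -
  have "i \<in> set [0..<length nb]" using assms(2) by simp
  note * = bspec[OF assms(1)[unfolded cubic_adj_def] this]
  show "length (nb ! i) = 3" "distinct (nb ! i)" using * by blast+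
  show "j \<in> set (nb ! i) \<Longrightarrow> j < length nb" "j \<in> set (nb ! i) \<Longrightarrow> j \<noteq> i"
    "j \<in> set (nb ! i) \<Longrightarrow> i \<in> set (nb ! j)" using * by blast+
qed

lemma regular_graph_adj_graph:
  assumes "cubic_adj nb"
  shows "regular_graph 3 (adj_graph nb)"
proof -
  note * = cubic_adjD[OF assms]
  have "parcs (adj_graph nb) \<subseteq> {..<length nb} \<times> {..<length nb}"
    using *(3) unfolding adj_graph_def by fastforce
  then have fin: "finite (parcs (adj_graph nb))" by (rule finite_subset) simp
  have "sym (parcs (adj_graph nb))"
  proof (rule symI)
    fix i j assume "(i, j) \<in> parcs (adj_graph nb)"
    then have "i < length nb" "j \<in> set (nb ! i)" by (simp_all add: adj_graph_def)
    then show "(j, i) \<in> parcs (adj_graph nb)"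
      using *(3,5)[of i j] by (simp add: adj_graph_def)
  qed
  then have sym: "symmetric (with_proj (adj_graph nb))"
    by (simp add: symmetric_def)
  have "pair_graph (adj_graph nb)"
  proof
    fix e assume "e \<in> parcs (adj_graph nb)"
    then have e: "fst e < length nb" "snd e \<in> set (nb ! fst e)" by (auto simp: adj_graph_def)
    show "fst e \<in> pverts (adj_graph nb)" "snd e \<in> pverts (adj_graph nb)"
      using e *(3)[OF e] by simp_all
    show "fst e \<noteq> snd e" using *(4)[OF e] by simp
  qed (use fin sym in auto)
  then show ?thesis
    using *(1,2) by (simp add: regular_graph_iff_card_nbrs nbrs_adj_graph distinct_card)
qed

definition girth_5_adj :: "nat list list \<Rightarrow> bool" where
  "girth_5_adj nb \<longleftrightarrow> (\<forall>a \<in> set [0..<length nb]. \<forall>b \<in> set (nb ! a). \<forall>c \<in> set (nb ! b).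
     c \<notin> set (nb ! a) \<and> (c \<noteq> a \<longrightarrow> (\<forall>d \<in> set (nb ! a). c \<in> set (nb ! d) \<longrightarrow> d = b)))"

lemma girth_adj_graph_ge_5:
  assumes "cubic_adj nb" "girth_5_adj nb"
  shows "5 \<le> graph_girth (adj_graph nb)"
proof -
  have G: "pair_graph (adj_graph nb)"
    using regular_graph_adj_graph[OF assms(1)] by (simp add: regular_graph_def)
  have N: "b \<in> nbrs (adj_graph nb) a \<longleftrightarrow> a < length nb \<and> b \<in> set (nb ! a)" for a b
    by (simp add: nbrs_def adj_graph_def)
  have "triangle_free (adj_graph nb) \<and> quad_free (adj_graph nb)"
    using assms(2) unfolding triangle_free_def quad_free_def girth_5_adj_def N
    by (metis atLeast_upt lessThan_iff)
  then show ?thesis using girth_ge_5_iff[OF G] by simp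
qed

text \<open>
  The list may repeat vertices; only membership in it is ever tested.
\<close>

primrec ball_adj :: "nat list list \<Rightarrow> nat \<Rightarrow> nat \<Rightarrow> nat list" where
  "ball_adj nb 0 u = [u]"
| "ball_adj nb (Suc n) u = u # concat (map (ball_adj nb n) (nb ! u))"

lemma set_ball_adj:
  assumes "cubic_adj nb" "u < length nb"
  shows "set (ball_adj nb n u) = ball_of (adj_graph nb) n u"
  using assms(2)
proof (induction n arbitrary: u)
  case (Suc n)
  have "w < length nb" if "w \<in> set (nb ! u)" for w
    using cubic_adjD(3)[OF assms(1) Suc.prems that] .
  then show ?case using Suc.prems Suc.IH by (simp add: nbrs_adj_graph)
qed simp

text \<open>
  An isomorphism from \<^term>\<open>adj_graph nb\<close> to \<^term>\<open>H\<close>, written as the list of images of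
  \<open>0, 1, \<dots>\<close>. Lists can be enumerated by a search, and each isomorphism is counted once because
  no value outside the vertex set is recorded.
\<close>

definition labelling :: "nat list list \<Rightarrow> 'a pair_pre_digraph \<Rightarrow> 'a list \<Rightarrow> bool" where
  "labelling nb H p \<longleftrightarrow> length p = length nb \<and> distinct p \<and> set p = pverts H \<and>
     (\<forall>i < length nb. nbrs H (p ! i) = (!) p ` set (nb ! i))"

lemma labellingI:
  assumes "distinct p" "set p = pverts H"
    and nbrs: "map (nbrs H) p = map (\<lambda>js. (!) p ` set js) nb"
  shows "labelling nb H p"
proof -
  have len: "length p = length nb" by (rule map_eq_imp_length_eq[OF nbrs])
  have "nbrs H (p ! i) = (!) p ` set (nb ! i)" if "i < length nb" for i
    using arg_cong[OF nbrs, of "\<lambda>xs. xs ! i"] that len by simp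
  then show ?thesis using assms len by (simp add: labelling_def)
qed

lemma labelling_map_iff:
  fixes nb H
  defines "G \<equiv> adj_graph nb"
  assumes "cubic_adj nb"
  shows "labelling nb H (map f [0..<length nb]) \<longleftrightarrow>
    bij_betw f (pverts G) (pverts H) \<and> (\<forall>u \<in> pverts G. nbrs H (f u) = f ` nbrs G u)"
proof -
  have nb: "(!) (map f [0..<length nb]) ` set (nb ! i) = f ` nbrs G i" if i: "i < length nb" for i
  proof -
    have "(!) (map f [0..<length nb]) ` set (nb ! i) = f ` set (nb ! i)"
      using cubic_adjD(3)[OF assms(2) i] by (intro image_cong) auto
    then show ?thesis using i by (simp add: nbrs_adj_graph G_def)
  qed
  have "(\<forall>i<length nb. nbrs H (map f [0..<length nb] ! i) = (!) (map f [0..<length nb]) ` set (nb ! i))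
      \<longleftrightarrow> (\<forall>i<length nb. nbrs H (f i) = f ` nbrs G i)"
    using nb by simp
  then show ?thesis
    unfolding labelling_def bij_betw_def distinct_map
    by (simp add: lessThan_atLeast0 Ball_def G_def)
qed

lemma graph_isomorphic_adj_graph_iff:
  assumes "cubic_adj nb" "pair_wf_digraph H"
  shows "graph_isomorphic (adj_graph nb) H \<longleftrightarrow> (\<exists>p. labelling nb H p)"
proof -
  have G: "pair_wf_digraph (adj_graph nb)"
    using regular_graph_adj_graph[OF assms(1)] by (simp add: regular_graph_def pair_graph_wf)
  have "p = map ((!) p) [0..<length nb]" if "labelling nb H p" for p
    using that map_nth[of p] by (simp add: labelling_def)
  then have "(\<exists>p. labelling nb H p) \<longleftrightarrow> (\<exists>f. labelling nb H (map f [0..<length nb]))"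
    by metis
  then show ?thesis
    unfolding graph_isomorphic_iff[OF G assms(2)] labelling_map_iff[OF assms(1)] by simp
qed

lemma order_AutoGroup_adj_graph:
  assumes "cubic_adj nb"
  shows "order (graph_AutoGroup (adj_graph nb)) = card {p. labelling nb (adj_graph nb) p}"
proof -
  let ?G = "adj_graph nb" and ?n = "length nb"
  let ?l = "\<lambda>f. map f [0..<?n]"
  have wf: "pair_wf_digraph ?G"
    using regular_graph_adj_graph[OF assms(1)] by (simp add: regular_graph_def pair_graph_wf)
  have auto_iff: "f \<in> graph_auto ?G \<longleftrightarrow> f \<in> extensional {..<?n} \<and> labelling nb ?G (?l f)" for f
  proof -
    have "(\<forall>u<?n. \<forall>v<?n. (f u, f v) \<in> parcs ?G \<longleftrightarrow> (u, v) \<in> parcs ?G) \<longleftrightarrow>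
      (\<forall>u<?n. nbrs ?G (f u) = f ` nbrs ?G u)" (is "?A \<longleftrightarrow> ?B") if f: "bij_betw f {..<?n} {..<?n}"
    proof
      assume A: ?A
      have "nbrs ?G (f u) \<subseteq> f ` nbrs ?G u" if u: "u < ?n" for u
      proof
        fix w assume w: "w \<in> nbrs ?G (f u)"
        then have "w < ?n" using nbrs_subset[OF wf] by auto
        then obtain v where "v < ?n" "w = f v" using f unfolding bij_betw_def by (metis imageE lessThan_iff)
        then show "w \<in> f ` nbrs ?G u" using A u w by (auto simp: nbrs_def)
      qed
      moreover have "f ` nbrs ?G u \<subseteq> nbrs ?G (f u)" if u: "u < ?n" for u
        using A u nbrs_subset[OF wf, of u] by (auto simp: nbrs_def)
      ultimately show ?B by blast
    next
      assume B: ?B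
      show ?A
      proof (intro allI impI)
        fix u v assume uv: "u < ?n" "v < ?n"
        have "f v \<in> f ` nbrs ?G u \<longleftrightarrow> v \<in> nbrs ?G u"
          using f uv nbrs_subset[OF wf, of u] by (auto simp: bij_betw_def inj_on_def)
        then show "(f u, f v) \<in> parcs ?G \<longleftrightarrow> (u, v) \<in> parcs ?G"
          using B uv by (simp add: nbrs_def set_eq_iff)
      qed
    qed
    then show ?thesis
      unfolding labelling_map_iff[OF assms] graph_auto_def Bij_def by auto
  qed
  have "bij_betw ?l (graph_auto ?G) {p. labelling nb ?G p}"
  proof (rule bij_betw_imageI)
    show "inj_on ?l (graph_auto ?G)"
    proof (rule inj_onI)
      fix f g assume "f \<in> graph_auto ?G" "g \<in> graph_auto ?G" and eq: "?l f = ?l g"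
      then have "f \<in> extensional {..<?n}" "g \<in> extensional {..<?n}" by (simp_all add: auto_iff)
      then show "f = g" by (rule extensionalityI) (use eq in auto)
    qed
    show "?l ` graph_auto ?G = {p. labelling nb ?G p}"
    proof (intro equalityI subsetI)
      fix p assume "p \<in> {p. labelling nb ?G p}"
      then have p: "labelling nb ?G p" by simp
      let ?f = "\<lambda>i \<in> {..<?n}. p ! i"
      have "length p = ?n" using p by (simp add: labelling_def)
      then have eq: "?l ?f = p" by (intro nth_equalityI) simp_all
      have "labelling nb ?G (?l ?f)" by (subst eq) (rule p)
      then have "?f \<in> graph_auto ?G" unfolding auto_iff by (intro conjI restrict_extensional)
      with eq[symmetric] show "p \<in> ?l ` graph_auto ?G" by (rule image_eqI)
    next
      fix p assume "p \<in> ?l ` graph_auto ?G"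
      then obtain f where "f \<in> graph_auto ?G" "p = ?l f" by blast
      then show "p \<in> {p. labelling nb ?G p}" by (simp only: auto_iff mem_Collect_eq)
    qed
  qed
  then show ?thesis
    by (simp add: order_def graph_AutoGroup_def bij_betw_same_card)
qed

text \<open>
  Backtracking search: \<^term>\<open>p\<close> lists the images chosen so far, and the image of the next
  vertex must be adjacent to the images of all its earlier neighbours \<open>js\<close>. If there is such a
  neighbour, only the vertices around its image, three in a cubic graph, have to be tried, which keeps the
  search small when the vertices are numbered in breadth-first order.
\<close>

definition candidates :: "nat list list \<Rightarrow> nat list list \<Rightarrow> nat list \<Rightarrow> nat list" where
  "candidates nb nc p =
     (let js = filter (\<lambda>j. j < length p) (nb ! length p)
      in filter (\<lambda>v. v \<notin> set p \<and> (\<forall>j \<in> set js. v \<in> set (nc ! (p ! j))))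
           (case js of [] \<Rightarrow> [0..<length nc] | j # _ \<Rightarrow> nc ! (p ! j)))"

primrec partial_labellings :: "nat list list \<Rightarrow> nat list list \<Rightarrow> nat \<Rightarrow> nat list list" where
  "partial_labellings nb nc 0 = [[]]"
| "partial_labellings nb nc (Suc k) =
     concat (map (\<lambda>p. map (\<lambda>v. p @ [v]) (candidates nb nc p)) (partial_labellings nb nc k))"

text \<open>
  The filter repeats the whole definition of a labelling. Hence nothing has to be proved about
  the lists that the search returns, only that it misses none.
\<close>

definition labellings :: "nat list list \<Rightarrow> nat list list \<Rightarrow> nat list list" where
  "labellings nb nc = filter (\<lambda>p. length p = length nb \<and> distinct p \<and> set p = set [0..<length nc] \<and>
     (\<forall>i \<in> set [0..<length nb]. set (nc ! (p ! i)) = set (map ((!) p) (nb ! i))))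
     (partial_labellings nb nc (length nb))"

lemma labelling_iff_labellings:
  assumes "cubic_adj nb"
  shows "labelling nb (adj_graph nc) p \<longleftrightarrow> p \<in> set (labellings nb nc)"
proof -
  \<comment> \<open>Completeness: every prefix of a labelling survives the pruning.\<close>
  have "take k p \<in> set (partial_labellings nb nc k)"
    if p: "labelling nb (adj_graph nc) p" and "k \<le> length nb" for k
    using that(2)
  proof (induction k)
    case (Suc k)
    let ?q = "take k p"
    have len: "length p = length nb" "length ?q = k" "k < length p"
      using p Suc.prems by (auto simp: labelling_def)
    have in_range: "p ! i < length nc" if "i < length p" for i
      using p that nth_mem[OF that] by (auto simp: labelling_def)
    moreover have "nbrs (adj_graph nc) (p ! i) = (!) p ` set (nb ! i)" if "i < length p" for i
      using p that by (simp add: labelling_def)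
    ultimately have img: "set (nc ! (p ! i)) = (!) p ` set (nb ! i)" if "i < length p" for i
      using that by (simp add: nbrs_adj_graph)
    have earlier: "p ! k \<in> set (nc ! (p ! j))" if "j \<in> set (nb ! k)" "j < k" for j
    proof -
      have "k \<in> set (nb ! j)" using cubic_adjD(5)[OF assms, of k j] that len by simp
      then show ?thesis using img[of j] that len by auto
    qed
    have new: "p ! k \<notin> set ?q"
      using p len by (auto simp: labelling_def in_set_conv_nth nth_eq_iff_index_eq)
    have "p ! k \<in> set (candidates nb nc ?q)"
    proof (cases "filter (\<lambda>j. j < k) (nb ! k)")
      case Nil
      then show ?thesis using in_range[OF len(3)] new len by (simp add: candidates_def)
    next
      case (Cons j js)
      have "i \<in> set (nb ! k) \<and> i < k" if "i \<in> set (j # js)" for i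
        using that unfolding Cons[symmetric] by simp
      then have "p ! k \<in> set (nc ! (?q ! i))" if "i \<in> set (j # js)" for i
        using earlier[of i] that by simp
      then show ?thesis using new len Cons by (simp add: candidates_def)
    qed
    then have "?q @ [p ! k] \<in> set (partial_labellings nb nc (Suc k))"
      using Suc by auto
    then show ?case using len by (simp add: take_Suc_conv_app_nth)
  qed simp
  note complete = this[of "length nb"]
  have "labelling nb (adj_graph nc) p \<longleftrightarrow>
    length p = length nb \<and> distinct p \<and> set p = set [0..<length nc] \<and>
    (\<forall>i \<in> set [0..<length nb]. set (nc ! (p ! i)) = set (map ((!) p) (nb ! i)))"
  proof (cases "length p = length nb \<and> set p = {..<length nc}")
    case True
    then have "p ! i < length nc" if "i < length nb" for i
      using that nth_mem[of i p] by simp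
    then show ?thesis
      using True by (simp add: labelling_def nbrs_adj_graph Ball_def lessThan_atLeast0)
  next
    case False
    then show ?thesis by (auto simp: labelling_def lessThan_atLeast0)
  qed
  moreover have "take (length nb) p = p" if "labelling nb (adj_graph nc) p"
    using that by (simp add: labelling_def)
  ultimately show ?thesis
    using complete unfolding labellings_def set_filter mem_Collect_eq by (metis le_refl)
qed

section \<open>A hexagon with chords\<close>

text \<open>
  The vertices \<open>4, \<dots>, 9\<close> are the corners of a hexagon in cyclic order. Its sides are not edges:
  alternate sides are replaced by paths of length 2 through \<open>1, 2, 3\<close>, the neighbours of the
  vertex \<open>0\<close>, and the remaining three by paths through \<open>10, 11, 12\<close>, the neighbours of the vertex
  \<open>13\<close>. The list \<^term>\<open>m\<close> gives the corner that is joined to each of \<open>4, \<dots>, 9\<close> by a chord.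
\<close>

definition capped_hexagon :: "nat list \<Rightarrow> nat list list" where
  "capped_hexagon m =
     [[1, 2, 3], [0, 4, 5], [0, 6, 7], [0, 8, 9],
      [1, 12, m ! 0], [1, 10, m ! 1], [2, 10, m ! 2], [2, 11, m ! 3], [3, 11, m ! 4], [3, 12, m ! 5],
      [5, 6, 13], [7, 8, 13], [4, 9, 13], [10, 11, 12]]"

text \<open>
  Three chords that each join opposite corners; or one such chord and the two short chords
  perpendicular to it, as seen in a regular hexagon.
\<close>

definition long_chords :: "nat list list" where
  "long_chords = capped_hexagon [7, 8, 9, 4, 5, 6]"

definition mixed_chords :: "nat list list" where
  "mixed_chords = capped_hexagon [7, 9, 8, 4, 6, 5]"

definition matching_on :: "'a set \<Rightarrow> ('a \<Rightarrow> 'a) \<Rightarrow> bool" where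
  "matching_on S p \<longleftrightarrow> (\<forall>s \<in> S. p s \<in> S \<and> p s \<noteq> s \<and> p (p s) = s)"

lemma matching_onD:
  assumes "matching_on S p" "s \<in> S"
  shows "p s \<in> S" "p s \<noteq> s" "p (p s) = s"
  using assms by (auto simp: matching_on_def)

text \<open>
  The union of two disjoint perfect matchings is a disjoint union of even cycles of length at
  least 4. Six points leave room for a single cycle only: a 4-cycle would leave over two
  points, and both matchings would pair these with each other.
\<close>

lemma two_matchings_hexagon:
  assumes S: "card S = 6" "s0 \<in> S"
    and p: "matching_on S p" and q: "matching_on S q"
    and pq: "\<forall>s \<in> S. p s \<noteq> q s"
  obtains s1 s2 s3 s4 s5 where "S = {s0, s1, s2, s3, s4, s5}" "distinct [s0, s1, s2, s3, s4, s5]"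
    "p s0 = s1" "q s1 = s2" "p s2 = s3" "q s3 = s4" "p s4 = s5" "q s5 = s0"
proof -
  note P = matching_onD[OF p] and Q = matching_onD[OF q]
  define s1 s2 s3 s4 s5 where "s1 = p s0" and "s2 = q s1" and "s3 = p s2" and "s4 = q s3" and "s5 = p s4"
  note d = this
  have fin: "finite S" using S(1) card.infinite by fastforce
  have in_S: "s1 \<in> S" "s2 \<in> S" "s3 \<in> S" "s4 \<in> S" "s5 \<in> S"
    using S(2) P(1) Q(1) by (auto simp: d)
  have dual: "p s1 = s0" "q s2 = s1" "p s3 = s2" "q s4 = s3" "p s5 = s4"
    using in_S S(2) P(3) Q(3) by (auto simp: d)
  have step: "p s0 = s1" "q s1 = s2" "p s2 = s3" "q s3 = s4" "p s4 = s5" by (simp_all add: d)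
  have d3: "distinct [s0, s1, s2, s3]"
    using step dual P(2)[OF S(2)] Q(2)[OF in_S(1)] P(2)[OF in_S(2)] pq[rule_format, OF in_S(1)] pq[rule_format, OF in_S(2)]
    by auto
  \<comment> \<open>Otherwise \<open>s0, s1, s2, s3\<close> is a 4-cycle and the two remaining points are paired twice.\<close>
  have "s4 \<noteq> s0"
  proof
    assume "s4 = s0"
    then have q03: "q s0 = s3" using dual by simp
    have "card (S - {s0, s1, s2, s3}) = 2"
      using d3 S in_S fin by (subst card_Diff_subset) auto
    then obtain t u where tu: "S - {s0, s1, s2, s3} = {t, u}" "t \<noteq> u"
      by (auto simp: card_2_iff)
    have t: "t \<in> S" "t \<notin> {s0, s1, s2, s3}" using tu by auto
    have "p ` {s0, s1, s2, s3} \<subseteq> {s0, s1, s2, s3}" "q ` {s0, s1, s2, s3} \<subseteq> {s0, s1, s2, s3}"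
      using step dual q03 \<open>s4 = s0\<close> by simp_all
    then have "p t \<notin> {s0, s1, s2, s3}" "q t \<notin> {s0, s1, s2, s3}"
      using t P(3)[OF t(1)] Q(3)[OF t(1)] by (metis imageI subsetD)+
    then have "p t \<in> {t, u}" "q t \<in> {t, u}"
      using t P(1) Q(1) tu(1) by blast+
    then show False using P(2)[OF t(1)] Q(2)[OF t(1)] pq[rule_format, OF t(1)] by auto
  qed
  moreover have "s4 \<notin> {s1, s2, s3}"
    using d3 step(2,4) dual(2,4) Q(2)[OF in_S(3)] by auto
  ultimately have d4: "distinct [s0, s1, s2, s3, s4]" using d3 by auto
  have "s5 \<notin> {s0, s1, s2, s3, s4}"
    using d4 step(1,3,5) dual(1,3,5) P(2)[OF in_S(4)] by auto
  then have d5: "distinct [s0, s1, s2, s3, s4, s5]" using d4 by auto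
  have Seq: "S = {s0, s1, s2, s3, s4, s5}"
  proof (rule sym, rule card_subset_eq[OF fin])
    show "card {s0, s1, s2, s3, s4, s5} = card S"
      using d5 S(1) by simp
  qed (use in_S S(2) in auto)
  have "q s5 \<notin> {s1, s2, s3, s4, s5}"
    using d5 step(2,4) dual(2,4) Q(2,3)[OF in_S(5)] by auto
  then have "q s5 = s0" using Q(1)[of s5] in_S Seq by blast
  then show thesis using that Seq d5 step by blast
qed

text \<open>
  The complement of the hexagon formed by \<^term>\<open>p\<close> and \<^term>\<open>q\<close> is a triangular prism, which
  has four perfect matchings: one consists of the three long diagonals, each of the other
  three contains exactly one of them. Rotations by two steps preserve both \<^term>\<open>p\<close> and
  \<^term>\<open>q\<close> and permute these three cyclically, so that \<open>s0\<close> can be chosen on a long diagonal.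
\<close>

lemma three_matchings:
  assumes S: "card S = 6"
    and p: "matching_on S p" and q: "matching_on S q" and m: "matching_on S m"
    and pq: "\<forall>s \<in> S. p s \<noteq> q s"
    and mp: "\<forall>s \<in> S. m s \<noteq> p s" and mq: "\<forall>s \<in> S. m s \<noteq> q s"
  obtains s0 s1 s2 s3 s4 s5 where
    "S = {s0, s1, s2, s3, s4, s5}" "distinct [s0, s1, s2, s3, s4, s5]"
    "p s0 = s1" "p s2 = s3" "p s4 = s5" "q s1 = s2" "q s3 = s4" "q s5 = s0"
    "m s0 = s3" "m s1 = s4 \<and> m s2 = s5 \<or> m s1 = s5 \<and> m s2 = s4"
proof -
  note M = matching_onD[OF m] and P = matching_onD[OF p] and Q = matching_onD[OF q]
  obtain s0 where "s0 \<in> S" using S by fastforce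
  then obtain s1 s2 s3 s4 s5 where h: "S = {s0, s1, s2, s3, s4, s5}" "distinct [s0, s1, s2, s3, s4, s5]"
    "p s0 = s1" "q s1 = s2" "p s2 = s3" "q s3 = s4" "p s4 = s5" "q s5 = s0"
    by (rule two_matchings_hexagon[OF S _ p q pq])
  have in_S: "s0 \<in> S" "s1 \<in> S" "s2 \<in> S" "s3 \<in> S" "s4 \<in> S" "s5 \<in> S"
    by (simp_all add: h(1))
  have dual: "p s1 = s0" "q s2 = s1" "p s3 = s2" "q s4 = s3" "p s5 = s4" "q s0 = s5"
    using P(3)[OF in_S(1)] P(3)[OF in_S(3)] P(3)[OF in_S(5)]
      Q(3)[OF in_S(2)] Q(3)[OF in_S(4)] Q(3)[OF in_S(6)] by (simp_all add: h)
  have "m s \<in> S - {s, p s, q s}" if "s \<in> S" for s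
    using M(1,2)[OF that] mp[rule_format, OF that] mq[rule_format, OF that] by blast
  from in_S[THEN this]
  have "m s0 \<in> S - {s0, s1, s5}" "m s1 \<in> S - {s1, s0, s2}" "m s2 \<in> S - {s2, s3, s1}"
    "m s3 \<in> S - {s3, s2, s4}" "m s4 \<in> S - {s4, s5, s3}" "m s5 \<in> S - {s5, s4, s0}"
    by (simp_all only: h(3-) dual)
  moreover have "S - {s0, s1, s5} \<subseteq> {s2, s3, s4}" "S - {s1, s0, s2} \<subseteq> {s3, s4, s5}"
    "S - {s2, s3, s1} \<subseteq> {s4, s5, s0}" "S - {s3, s2, s4} \<subseteq> {s5, s0, s1}"
    "S - {s4, s5, s3} \<subseteq> {s0, s1, s2}" "S - {s5, s4, s0} \<subseteq> {s1, s2, s3}"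
    unfolding h(1) by blast+
  ultimately have ms: "m s0 \<in> {s2, s3, s4}" "m s1 \<in> {s3, s4, s5}" "m s2 \<in> {s4, s5, s0}"
    "m s3 \<in> {s5, s0, s1}" "m s4 \<in> {s0, s1, s2}" "m s5 \<in> {s1, s2, s3}"
    by (meson subsetD)+
  have inv: "m (m s0) = s0" "m (m s1) = s1" "m (m s2) = s2" "m (m s3) = s3" "m (m s4) = s4" "m (m s5) = s5"
    using in_S[THEN M(3)] by simp_all
  have case_s2: "m s4 = s1 \<and> m s5 = s3" if "m s0 = s2"
    using that ms(5,6) inv h(2) by auto
  have case_s3: "m s1 = s4 \<and> m s2 = s5 \<or> m s1 = s5 \<and> m s2 = s4" if "m s0 = s3"
    using that ms(2,3) inv h(2) by auto
  have case_s4: "m s2 = s5 \<and> m s3 = s1 \<and> m s4 = s0" if "m s0 = s4"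
    using that ms(3,4) inv h(2) by auto
  consider "m s0 = s3" "m s1 = s4" "m s2 = s5" | "m s0 = s3" "m s1 = s5" "m s2 = s4"
    | "m s2 = s5" "m s3 = s1" "m s4 = s0" | "m s4 = s1" "m s5 = s3" "m s0 = s2"
    using ms(1) case_s2 case_s3 case_s4 by blast
  then show thesis
  proof cases
    case 1
    show thesis
      by (rule that[of s0 s1 s2 s3 s4 s5]) (use 1 h in simp_all)
  next
    case 2
    show thesis
      by (rule that[of s0 s1 s2 s3 s4 s5]) (use 2 h in simp_all)
  next
    case 3
    show thesis
      by (rule that[of s2 s3 s4 s5 s0 s1]) (use 3 h in auto)
  next
    case 4
    show thesis
      by (rule that[of s4 s5 s0 s1 s2 s3]) (use 4 h in auto)
  qed
qed

section \<open>Cubic graphs with a pair of vertices at distance 4\<close>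

text \<open>
  In a graph without triangles and quadrilaterals these are exactly the vertices at distance 2
  from \<^term>\<open>c\<close>, and each of them has a unique common neighbour with \<^term>\<open>c\<close>, its parent.
\<close>

definition sphere2 :: "'a pair_pre_digraph \<Rightarrow> 'a \<Rightarrow> 'a set" where
  "sphere2 H c = (\<Union>u \<in> nbrs H c. nbrs H u - {c})"

definition parent :: "'a pair_pre_digraph \<Rightarrow> 'a \<Rightarrow> 'a \<Rightarrow> 'a" where
  "parent H c s = (THE u. u \<in> nbrs H c \<and> u \<in> nbrs H s)"

definition sibling :: "'a pair_pre_digraph \<Rightarrow> 'a \<Rightarrow> 'a \<Rightarrow> 'a" where
  "sibling H c s = (THE t. t \<in> nbrs H (parent H c s) - {c, s})"

locale cubic_girth_5 =
  fixes H :: "'a pair_pre_digraph"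
  assumes regular: "regular_graph 3 H"
    and no_triangle: "triangle_free H"
    and no_quad: "quad_free H"
begin

abbreviation N where "N \<equiv> nbrs H"

lemma graph: "pair_graph H"
  using regular by (simp add: regular_graph_def)

lemma card_N: "v \<in> pverts H \<Longrightarrow> card (N v) = 3"
  using regular by (simp add: regular_graph_iff_card_nbrs)

lemma N_vertex: "w \<in> N v \<Longrightarrow> v \<in> pverts H" "w \<in> N v \<Longrightarrow> w \<in> pverts H"
  using nbrs_subset[OF pair_graph_wf[OF graph]] nbrs_nonvertex[OF pair_graph_wf[OF graph]]
  by blast+

lemma N_sym: "w \<in> N v \<Longrightarrow> v \<in> N w"
  by (rule nbrs_sym[OF graph])

lemma N_irrefl: "v \<notin> N v"
  by (rule nbrs_irrefl[OF graph])

lemma finite_N: "finite (N v)"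
  by (rule finite_subset[OF nbrs_subset[OF pair_graph_wf[OF graph]] pair_graph_finite[OF graph]])

lemma triangleD: "b \<in> N a \<Longrightarrow> c \<in> N b \<Longrightarrow> c \<notin> N a"
  by (rule no_triangle[unfolded triangle_free_def, rule_format])

lemma quadD: "b \<in> N a \<Longrightarrow> c \<in> N b \<Longrightarrow> c \<noteq> a \<Longrightarrow> d \<in> N a \<Longrightarrow> c \<in> N d \<Longrightarrow> d = b"
  by (rule no_quad[unfolded quad_free_def, rule_format])

lemma sphere2_iff: "s \<in> sphere2 H c \<longleftrightarrow> s \<noteq> c \<and> (\<exists>u \<in> N c. s \<in> N u)"
  by (auto simp: sphere2_def)

lemma sphere2_vertex: "s \<in> sphere2 H c \<Longrightarrow> s \<in> pverts H"
  using N_vertex(2) unfolding sphere2_iff by blast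

lemma card_sphere2:
  assumes "c \<in> pverts H"
  shows "card (sphere2 H c) = 6"
proof -
  have "card (N u - {c}) = 2" if "u \<in> N c" for u
    using card_N[OF N_vertex(2)[OF that]] N_sym[OF that] finite_N[of u]
    by (simp add: card_Diff_singleton)
  moreover have "card (sphere2 H c) = (\<Sum>u \<in> N c. card (N u - {c}))"
    unfolding sphere2_def
  proof (rule card_UN_disjoint)
    show "\<forall>u \<in> N c. \<forall>w \<in> N c. u \<noteq> w \<longrightarrow> (N u - {c}) \<inter> (N w - {c}) = {}"
      using quadD[of _ c] by blast
  qed (simp_all add: finite_N)
  ultimately show ?thesis using card_N[OF assms] by simp
qed

lemma parent_eqI:
  assumes "s \<in> sphere2 H c" "u \<in> N c" "u \<in> N s"
  shows "parent H c s = u"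
  unfolding parent_def
proof (rule the_equality)
  fix w assume "w \<in> N c \<and> w \<in> N s"
  moreover have "s \<noteq> c" using assms(1) by (simp add: sphere2_iff)
  ultimately show "w = u"
    using quadD[of u c s w] assms(2) N_sym[OF assms(3)] N_sym[of w s] by blast
qed (use assms in auto)

lemma parent:
  assumes "s \<in> sphere2 H c"
  shows "parent H c s \<in> N c" "parent H c s \<in> N s"
proof -
  obtain u where u: "u \<in> N c" "s \<in> N u" using assms by (auto simp: sphere2_iff)
  then have "u \<in> N s" by (simp only: N_sym)
  from parent_eqI[OF assms u(1) this] show "parent H c s \<in> N c" "parent H c s \<in> N s"
    using u(1) \<open>u \<in> N s\<close> by simp_all
qed

lemma nbrs_parent:
  assumes s: "s \<in> sphere2 H c"
  shows "N (parent H c s) = {c, s, sibling H c s}" "sibling H c s \<notin> {c, s}"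
proof -
  let ?u = "parent H c s"
  have cs: "c \<in> N ?u" "s \<in> N ?u" "s \<noteq> c"
    using N_sym[OF parent(1)[OF s]] N_sym[OF parent(2)[OF s]] s by (simp_all add: sphere2_iff)
  have "card (N ?u) = 3" by (rule card_N[OF N_vertex(2)[OF parent(1)[OF s]]])
  then have "card (N ?u - {c, s}) = 1"
    using cs finite_N[of ?u] by (simp add: card_Diff_subset)
  then obtain t where t: "N ?u - {c, s} = {t}" by (auto simp: card_1_singleton_iff)
  then have "sibling H c s = t" unfolding sibling_def t by simp
  then show "N ?u = {c, s, sibling H c s}" "sibling H c s \<notin> {c, s}"
    using t cs by auto
qed

lemma sibling_in_sphere2:
  assumes "s \<in> sphere2 H c"
  shows "sibling H c s \<in> sphere2 H c"
proof -
  have "sibling H c s \<in> N (parent H c s)" unfolding nbrs_parent(1)[OF assms] by simp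
  then show ?thesis
    using nbrs_parent(2)[OF assms] parent(1)[OF assms] unfolding sphere2_iff by blast
qed

lemma parent_sibling:
  assumes "s \<in> sphere2 H c"
  shows "parent H c (sibling H c s) = parent H c s"
proof (rule parent_eqI[OF sibling_in_sphere2[OF assms] parent(1)[OF assms] N_sym])
  show "sibling H c s \<in> N (parent H c s)" unfolding nbrs_parent(1)[OF assms] by simp
qed

lemma matching_sibling: "matching_on (sphere2 H c) (sibling H c)"
  unfolding matching_on_def
proof (intro ballI conjI)
  fix s assume s: "s \<in> sphere2 H c"
  let ?t = "sibling H c s"
  show "?t \<in> sphere2 H c" by (rule sibling_in_sphere2[OF s])
  show "?t \<noteq> s" using nbrs_parent(2)[OF s] by simp
  have "{c, s, ?t} = {c, ?t, sibling H c ?t}"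
    using nbrs_parent(1)[OF sibling_in_sphere2[OF s]]
    unfolding parent_sibling[OF s] nbrs_parent(1)[OF s] .
  then show "sibling H c ?t = s"
    using nbrs_parent(2)[OF s] nbrs_parent(2)[OF sibling_in_sphere2[OF s]] by blast
qed

end

text \<open>
  A pair \<^term>\<open>x\<close>, \<^term>\<open>y\<close> with no walk of length at most 3 between them. The numbers
  force the structure: \<open>1 + 3 + 6\<close> vertices lie within distance 2 of \<^term>\<open>x\<close>, the
  \<open>3 + 1\<close> vertices in the closed neighbourhood of \<^term>\<open>y\<close> are different from these, and there are
  only 14 in total.
\<close>

locale antipodal_cubic_14 = cubic_girth_5 H for H :: "'a pair_pre_digraph" +
  fixes x y :: 'a
  assumes card_verts: "card (pverts H) = 14"
    and x: "x \<in> pverts H" and y: "y \<in> pverts H"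
    and far: "y \<notin> ball_of H 3 x"
begin

lemma far_walk: "y \<noteq> x" "y \<notin> N x" "u \<in> N x \<Longrightarrow> y \<notin> N u" "u \<in> N x \<Longrightarrow> v \<in> N u \<Longrightarrow> y \<notin> N v"
  using far by (auto simp: numeral_3_eq_3)

abbreviation S where "S \<equiv> sphere2 H x"

lemma disjoint_layers:
  "x \<notin> N x" "x \<notin> S" "x \<notin> N y" "x \<noteq> y" "N x \<inter> S = {}" "N x \<inter> N y = {}" "y \<notin> N x"
  "S \<inter> N y = {}" "y \<notin> S" "y \<notin> N y"
proof -
  show "x \<notin> N x" "y \<notin> N y" by (rule N_irrefl)+
  show "x \<notin> N y" "x \<noteq> y" "y \<notin> N x" using far_walk(1,2) N_sym by blast+
  show "x \<notin> S" "y \<notin> S" using far_walk(2,3) unfolding sphere2_iff by blast+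
  show "N x \<inter> S = {}" using triangleD unfolding disjoint_iff sphere2_iff by blast
  show "N x \<inter> N y = {}" using far_walk(3) N_sym by blast
  show "S \<inter> N y = {}" using far_walk(4) N_sym unfolding disjoint_iff sphere2_iff by blast
qed

lemma verts_eq: "pverts H = insert x (N x \<union> S \<union> N y \<union> {y})"
proof (rule sym, rule card_subset_eq[OF pair_graph_finite[OF graph]])
  show "insert x (N x \<union> S \<union> N y \<union> {y}) \<subseteq> pverts H"
    using x y N_vertex(2) sphere2_vertex by blast
  have fin: "finite S" by (rule finite_subset[OF _ pair_graph_finite[OF graph]]) (auto intro: sphere2_vertex)
  have "card (N x \<union> S) = 9"
    using card_Un_disjoint[OF finite_N fin disjoint_layers(5)] card_N[OF x] card_sphere2[OF x] by simp
  moreover have "card (N x \<union> S \<union> N y) = card (N x \<union> S) + card (N y)"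
    using finite_N fin disjoint_layers(6,8) by (intro card_Un_disjoint) auto
  ultimately have "card (N x \<union> S \<union> N y) = 12" using card_N[OF y] by simp
  then show "card (insert x (N x \<union> S \<union> N y \<union> {y})) = card (pverts H)"
    using finite_N fin disjoint_layers card_verts by simp
qed

text \<open>
  A vertex of the left-hand side is too far from \<^term>\<open>x\<close> to be \<^term>\<open>x\<close> or one of its
  neighbours, and it is not a neighbour of \<^term>\<open>y\<close> because there are no triangles. So it is in the
  middle layer, and both spheres have six elements. Hence the middle layer is partitioned into
  pairs of siblings from either end.
\<close>

lemma sphere2_y: "sphere2 H y = S"
proof (rule card_subset_eq)
  show "finite S" by (rule finite_subset[OF _ pair_graph_finite[OF graph]]) (auto intro: sphere2_vertex)
  show "card (sphere2 H y) = card S" by (simp add: card_sphere2 x y)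
  show "sphere2 H y \<subseteq> S"
  proof
    fix s assume s: "s \<in> sphere2 H y"
    then obtain u where u: "u \<in> N y" "s \<in> N u" "s \<noteq> y" by (auto simp: sphere2_iff)
    have "s \<noteq> x" using u far_walk(3) N_sym by blast
    moreover have "s \<notin> N x" using u far_walk(4) N_sym by blast
    moreover have "s \<notin> N y" using u triangleD by blast
    ultimately show "s \<in> S" using sphere2_vertex[OF s] u(3) unfolding verts_eq by blast
  qed
qed

abbreviation a where "a \<equiv> parent H x"
abbreviation b where "b \<equiv> parent H y"

definition mate :: "'a \<Rightarrow> 'a" where "mate s = (THE t. t \<in> N s \<inter> S)"

text \<open>
  Two of the three neighbours of a middle vertex are its parents on the two sides. The third
  cannot lie in either neighbourhood, since parents are unique, and so is again in the middle.
\<close>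

lemma nbrs_S:
  assumes s: "s \<in> S"
  shows "N s = {a s, b s, mate s}" "N s \<inter> S = {mate s}"
proof -
  have s': "s \<in> sphere2 H y" using s sphere2_y by simp
  note A = parent[OF s] and B = parent[OF s']
  have ab: "a s \<noteq> b s" using A(1) B(1) disjoint_layers(6) by auto
  have "card (N s) = 3" by (rule card_N[OF sphere2_vertex[OF s]])
  then have "card (N s - {a s, b s}) = 1"
    using A(2) B(2) ab finite_N[of s] by (simp add: card_Diff_subset)
  then obtain t where t: "N s - {a s, b s} = {t}" by (auto simp: card_1_singleton_iff)
  then have ts: "t \<in> N s" "t \<noteq> a s" "t \<noteq> b s" by auto
  have "s \<notin> N x" "s \<notin> N y" using s disjoint_layers(5,8) by auto
  then have "t \<noteq> x" "t \<noteq> y" using N_sym[OF ts(1)] by auto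
  moreover have "t \<notin> N x" "t \<notin> N y"
    using parent_eqI[OF s _ ts(1)] parent_eqI[OF s' _ ts(1)] ts by auto
  ultimately have "t \<in> S" using N_vertex(2)[OF ts(1)] unfolding verts_eq by blast
  moreover have "a s \<notin> S" "b s \<notin> S" using A(1) B(1) disjoint_layers(5,8) by auto
  ultimately have NS: "N s \<inter> S = {t}" using t by auto
  then have "mate s = t" unfolding mate_def NS by simp
  then show "N s = {a s, b s, mate s}" "N s \<inter> S = {mate s}" using t NS A(2) B(2) by auto
qed

lemma matching_mate: "matching_on S mate"
  unfolding matching_on_def
proof (intro ballI conjI)
  fix s assume s: "s \<in> S"
  then have m: "mate s \<in> N s" "mate s \<in> S" using nbrs_S(2) by blast+
  show "mate s \<in> S" by (rule m)
  show "mate s \<noteq> s" using m N_irrefl by metis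
  have "s \<in> N (mate s) \<inter> S" using N_sym[OF m(1)] s by simp
  then show "mate (mate s) = s" using nbrs_S(2)[OF m(2)] by simp
qed

lemma labelling_exists:
  "\<exists>p. labelling (capped_hexagon [7, 8, 9, 4, 5, 6]) H p \<or>
       labelling (capped_hexagon [7, 9, 8, 4, 6, 5]) H p"
proof -
  let ?p = "sibling H x" and ?q = "sibling H y"
  have q: "matching_on S ?q" using matching_sibling[of y] by (simp add: sphere2_y)
  \<comment> \<open>Siblings on both sides would form a quadrilateral with their two parents.\<close>
  have pq: "\<forall>s \<in> S. ?p s \<noteq> ?q s"
  proof (intro ballI notI)
    fix s assume s: "s \<in> S" and eq: "?p s = ?q s"
    have s': "s \<in> sphere2 H y" using s sphere2_y by simp
    have "?p s \<in> N (a s)" "?p s \<in> N (b s)" "?p s \<noteq> s"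
      using nbrs_parent(2)[OF s] unfolding nbrs_parent(1)[OF s] nbrs_parent(1)[OF s'] eq by simp_all
    then have "b s = a s"
      using quadD[of "a s" s "?p s" "b s"] parent(2)[OF s] parent(2)[OF s'] by blast
    then show False using parent(1)[OF s] parent(1)[OF s'] disjoint_layers(6) by auto
  qed
  \<comment> \<open>Adjacent siblings would form a triangle with their parent.\<close>
  have no_sibling_mate: "mate s \<noteq> sibling H c s" if "s \<in> S" "s \<in> sphere2 H c" for s c
  proof -
    have "sibling H c s \<in> N (parent H c s)" unfolding nbrs_parent(1)[OF that(2)] by simp
    then have "sibling H c s \<notin> N s" by (rule triangleD[OF parent(2)[OF that(2)]])
    moreover have "mate s \<in> N s" unfolding nbrs_S(1)[OF that(1)] by simp
    ultimately show ?thesis by metis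
  qed
  have mp: "\<forall>s \<in> S. mate s \<noteq> ?p s" and mq: "\<forall>s \<in> S. mate s \<noteq> ?q s"
    by (simp_all add: no_sibling_mate sphere2_y)
  obtain s0 s1 s2 s3 s4 s5 where h: "S = {s0, s1, s2, s3, s4, s5}" "distinct [s0, s1, s2, s3, s4, s5]"
    "?p s0 = s1" "?p s2 = s3" "?p s4 = s5" "?q s1 = s2" "?q s3 = s4" "?q s5 = s0"
    "mate s0 = s3" and alt: "mate s1 = s4 \<and> mate s2 = s5 \<or> mate s1 = s5 \<and> mate s2 = s4"
    by (rule three_matchings[OF card_sphere2[OF x] matching_sibling q matching_mate pq mp mq])
  have in_S: "s0 \<in> S" "s1 \<in> S" "s2 \<in> S" "s3 \<in> S" "s4 \<in> S" "s5 \<in> S"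
    by (simp_all add: h(1))
  note in_S' = in_S[folded sphere2_y]
  define a0 a2 a4 b1 b3 b5 where
    "a0 = a s0" and "a2 = a s2" and "a4 = a s4" and "b1 = b s1" and "b3 = b s3" and "b5 = b s5"
  note d = this
  have a_eq: "a s0 = a0" "a s1 = a0" "a s2 = a2" "a s3 = a2" "a s4 = a4" "a s5 = a4"
    using parent_sibling[OF in_S(1)] parent_sibling[OF in_S(3)] parent_sibling[OF in_S(5)]
    by (simp_all add: h d)
  have b_eq: "b s0 = b5" "b s1 = b1" "b s2 = b1" "b s3 = b3" "b s4 = b3" "b s5 = b5"
    using parent_sibling[OF in_S'(2)] parent_sibling[OF in_S'(4)] parent_sibling[OF in_S'(6)]
    by (simp_all add: h d)
  have Na: "N a0 = {x, s0, s1}" "N a2 = {x, s2, s3}" "N a4 = {x, s4, s5}"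
    using nbrs_parent(1)[OF in_S(1)] nbrs_parent(1)[OF in_S(3)] nbrs_parent(1)[OF in_S(5)]
    by (simp_all add: h a_eq)
  have Nb: "N b1 = {s1, s2, y}" "N b3 = {s3, s4, y}" "N b5 = {s0, s5, y}"
    using nbrs_parent(1)[OF in_S'(2)] nbrs_parent(1)[OF in_S'(4)] nbrs_parent(1)[OF in_S'(6)]
    by (auto simp add: h b_eq)
  have not_in_S: "x \<notin> S" "y \<notin> S" by (rule disjoint_layers)+
  have Nx: "N x = {a0, a2, a4}" and da: "distinct [a0, a2, a4]"
  proof -
    show da: "distinct [a0, a2, a4]"
      using Na h(2) not_in_S unfolding h(1) by auto
    have "{a0, a2, a4} \<subseteq> N x" using in_S[THEN parent(1)] by (simp add: a_eq)
    from card_subset_eq[OF finite_N this] show "N x = {a0, a2, a4}"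
      using da card_N[OF x] by simp
  qed
  have Ny: "N y = {b1, b3, b5}" and db: "distinct [b1, b3, b5]"
  proof -
    show db: "distinct [b1, b3, b5]"
      using Nb h(2) not_in_S unfolding h(1) by auto
    have "{b1, b3, b5} \<subseteq> N y" using in_S'[THEN parent(1)] by (simp add: b_eq)
    from card_subset_eq[OF finite_N this] show "N y = {b1, b3, b5}"
      using db card_N[OF y] by simp
  qed
  \<comment> \<open>The order of the vertices in \<open>capped_hexagon\<close>.\<close>
  let ?l = "[x, a0, a2, a4, s0, s1, s2, s3, s4, s5, b1, b3, b5, y]"
  have set_l: "set ?l = pverts H"
    unfolding verts_eq Nx Ny h(1) by auto
  then have dist_l: "distinct ?l"
    using card_verts by (intro card_distinct) simp
  have inv: "mate s3 = s0" "mate s1 = t \<Longrightarrow> mate t = s1" "mate s2 = t \<Longrightarrow> mate t = s2" for t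
    using in_S[THEN matching_onD(3)[OF matching_mate]] h(9) by auto
  note NS = in_S[THEN nbrs_S(1), unfolded a_eq b_eq]
  from alt show ?thesis
  proof
    assume "mate s1 = s4 \<and> mate s2 = s5"
    then have "labelling (capped_hexagon [7, 8, 9, 4, 5, 6]) H ?l"
      using inv(1) inv(2)[of s4] inv(3)[of s5] h(9) NS
      by (intro labellingI[OF dist_l set_l]) (simp_all add: capped_hexagon_def Nx Ny Na Nb)
    then show ?thesis by blast
  next
    assume "mate s1 = s5 \<and> mate s2 = s4"
    then have "labelling (capped_hexagon [7, 9, 8, 4, 6, 5]) H ?l"
      using inv(1) inv(2)[of s5] inv(3)[of s4] h(9) NS
      by (intro labellingI[OF dist_l set_l]) (simp_all add: capped_hexagon_def Nx Ny Na Nb)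
    then show ?thesis by blast
  qed
qed

end

section \<open>The two graphs\<close>

text \<open>
  The vertices 0 and 13 are the two ends of \<^const>\<open>capped_hexagon\<close>, which realise the diameter.
\<close>

definition diameter_4_adj :: "nat list list \<Rightarrow> bool" where
  "diameter_4_adj nb \<longleftrightarrow>
     (\<forall>u \<in> set [0..<length nb]. \<forall>v \<in> set [0..<length nb]. v \<in> set (ball_adj nb 4 u)) \<and>
     13 < length nb \<and> 13 \<notin> set (ball_adj nb 3 0)"

lemma diameter_adj_graph:
  assumes nb: "cubic_adj nb" "diameter_4_adj nb"
  shows "graph_diameter (adj_graph nb) = 4"
proof -
  let ?G = "adj_graph nb"
  have wf: "pair_wf_digraph ?G"
    using regular_graph_adj_graph[OF nb(1)] by (simp add: regular_graph_def pair_graph_wf)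
  have n: "13 < length nb" using nb(2) by (simp add: diameter_4_adj_def)
  have pos: "0 < length nb" using n by linarith
  have "\<forall>u \<in> pverts ?G. pverts ?G \<subseteq> ball_of ?G (Suc 3) u"
  proof (intro ballI subsetI)
    fix u v assume "u \<in> pverts ?G" "v \<in> pverts ?G"
    then have "u < length nb" "v < length nb" by simp_all
    then have "v \<in> set (ball_adj nb (Suc 3) u)"
      using nb(2) by (simp add: diameter_4_adj_def)
    then show "v \<in> ball_of ?G (Suc 3) u"
      unfolding set_ball_adj[OF nb(1) \<open>u < length nb\<close>] .
  qed
  moreover have "13 \<notin> ball_of ?G 3 0"
    using nb(2) set_ball_adj[OF nb(1) pos, of 3] unfolding diameter_4_adj_def by blast
  then have "\<exists>u \<in> pverts ?G. \<exists>v \<in> pverts ?G. v \<notin> ball_of ?G 3 u"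
    using n pos by (metis lessThan_iff pverts_adj_graph)
  ultimately have "graph_diameter ?G = ereal (Suc 3)"
    unfolding graph_diameter_eq_Suc_iff[OF wf] by blast
  then show ?thesis by simp
qed

lemma code_checks:
  "cubic_adj long_chords" "girth_5_adj long_chords" "diameter_4_adj long_chords"
  "cubic_adj mixed_chords" "girth_5_adj mixed_chords" "diameter_4_adj mixed_chords"
  by code_simp+

lemma card_automorphisms:
  "card (set (labellings long_chords long_chords)) = 12"
  "card (set (labellings mixed_chords mixed_chords)) = 4"
  by code_simp+

lemma no_isomorphism: "labellings long_chords mixed_chords = []"
  by code_simp

text \<open>
  The hexagon corners 4 and 7 are opposite. The long chord between them closes a pentagon with
  their two parents and the vertex 0, so that the girth does not exceed 5.
\<close>

lemma circuit_capped_hexagon: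
  assumes wf: "pair_wf_digraph (adj_graph (capped_hexagon m))" and "m ! 0 = 7" "m ! 3 = 4"
  shows "circuit (adj_graph (capped_hexagon m)) [(0, 1), (1, 4), (4, 7), (7, 2), (2, 0)]"
  unfolding circuit_iff[OF wf] using assms
  by (auto simp: adj_graph_def capped_hexagon_def)

lemma chord_graph:
  assumes nb: "nb = long_chords \<or> nb = mixed_chords"
  shows "regular_graph 3 (adj_graph nb)" "graph_girth (adj_graph nb) = 5"
    and "graph_diameter (adj_graph nb) = 4" "card (pverts (adj_graph nb)) = 14"
    and "order (graph_AutoGroup (adj_graph nb)) = card (set (labellings nb nb))"
proof -
  have checks: "cubic_adj nb" "girth_5_adj nb" "diameter_4_adj nb"
    using nb code_checks by auto
  show reg: "regular_graph 3 (adj_graph nb)" by (rule regular_graph_adj_graph[OF checks(1)])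
  then have wf: "pair_wf_digraph (adj_graph nb)" by (simp add: regular_graph_def pair_graph_wf)
  have "circuit (adj_graph nb) [(0, 1), (1, 4), (4, 7), (7, 2), (2, 0)]"
    using nb wf circuit_capped_hexagon[of "[7, 8, 9, 4, 5, 6]"]
      circuit_capped_hexagon[of "[7, 9, 8, 4, 6, 5]"]
    by (auto simp: long_chords_def mixed_chords_def)
  then have "graph_girth (adj_graph nb) \<le> 5"
    unfolding graph_girth_def by (intro INF_lower2) (auto simp: numeral_eq_enat)
  then show "graph_girth (adj_graph nb) = 5"
    using girth_adj_graph_ge_5[OF checks(1,2)] by (rule antisym)
  show "graph_diameter (adj_graph nb) = 4" by (rule diameter_adj_graph[OF checks(1,3)])
  show "card (pverts (adj_graph nb)) = 14"
    using nb by (auto simp: long_chords_def mixed_chords_def capped_hexagon_def)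
  show "order (graph_AutoGroup (adj_graph nb)) = card (set (labellings nb nb))"
    unfolding order_AutoGroup_adj_graph[OF checks(1)] labelling_iff_labellings[OF checks(1)] by simp
qed

text \<open>
  The diameter supplies two vertices that no walk of length at most 3 joins; all else is the
  structure around such a pair.
\<close>

lemma isomorphic_to_chord_graph:
  assumes reg: "regular_graph 3 H" and girth: "graph_girth H = 5"
    and diam: "graph_diameter H = 4" and card: "card (pverts H) = 14"
  shows "graph_isomorphic H (adj_graph long_chords) \<or> graph_isomorphic H (adj_graph mixed_chords)"
proof -
  have G: "pair_graph H" using reg by (simp add: regular_graph_def)
  note wf = pair_graph_wf[OF G]
  have free: "triangle_free H" "quad_free H"
    using girth_ge_5_iff[OF G] girth by simp_all
  have "graph_diameter H = ereal (Suc 3)" using diam by simp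
  then obtain x y where "x \<in> pverts H" "y \<in> pverts H" "y \<notin> ball_of H 3 x"
    unfolding graph_diameter_eq_Suc_iff[OF wf] by blast
  then interpret antipodal_cubic_14 H x y
    using reg free card by unfold_locales
  show ?thesis
    using labelling_exists code_checks(1,4) graph_isomorphic_sym[of _ H]
      graph_isomorphic_adj_graph_iff[OF _ wf]
    unfolding long_chords_def mixed_chords_def by blast
qed

theorem mainTheorem2:
  "\<exists>(G1 :: nat pair_pre_digraph) (G2 :: nat pair_pre_digraph).
     (regular_graph 3 G1 \<and> graph_girth G1 = 5 \<and> graph_diameter G1 = 4 \<and>
        card (pverts G1) = 3\<^sup>2 + 3 + 2) \<and>
     (regular_graph 3 G2 \<and> graph_girth G2 = 5 \<and> graph_diameter G2 = 4 \<and>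
        card (pverts G2) = 3\<^sup>2 + 3 + 2) \<and>
     \<not> graph_isomorphic G1 G2 \<and>
     (\<forall>H :: 'a pair_pre_digraph.
        regular_graph 3 H \<and> graph_girth H = 5 \<and> graph_diameter H = 4 \<and>
          card (pverts H) = 3\<^sup>2 + 3 + 2 \<longrightarrow>
        graph_isomorphic H G1 \<or> graph_isomorphic H G2) \<and>
     order (graph_AutoGroup G1) = 12 \<and>
     order (graph_AutoGroup G2) = 4"
proof -
  let ?G1 = "adj_graph long_chords" and ?G2 = "adj_graph mixed_chords"
  have order: "(3::nat)\<^sup>2 + 3 + 2 = 14" by simp
  have G1: "long_chords = long_chords \<or> long_chords = mixed_chords"
    and G2: "mixed_chords = long_chords \<or> mixed_chords = mixed_chords" by simp_all
  have "pair_wf_digraph ?G2"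
    using chord_graph(1)[OF G2] by (simp add: regular_graph_def pair_graph_wf)
  then have "\<not> graph_isomorphic ?G1 ?G2"
    unfolding graph_isomorphic_adj_graph_iff[OF code_checks(1) \<open>pair_wf_digraph ?G2\<close>]
      labelling_iff_labellings[OF code_checks(1)] no_isomorphism by simp
  moreover have "graph_isomorphic H ?G1 \<or> graph_isomorphic H ?G2"
    if "regular_graph 3 H \<and> graph_girth H = 5 \<and> graph_diameter H = 4 \<and> card (pverts H) = 14"
    for H :: "'a pair_pre_digraph"
    using that isomorphic_to_chord_graph by blast
  moreover have "order (graph_AutoGroup ?G1) = 12" "order (graph_AutoGroup ?G2) = 4"
    by (simp_all only: chord_graph(5)[OF G1] chord_graph(5)[OF G2] card_automorphisms)
  ultimately show ?thesis
    unfolding order using chord_graph(1-4)[OF G1] chord_graph(1-4)[OF G2]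
    by (intro exI[of _ ?G1] exI[of _ ?G2]) simp
qed

end
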